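(* Let $x,y$ be real numbers, let $k\ge 1$ be an integer, and let $n=2k$ or $n=2k-1$. Then $$(1-x)^{n}+\sum_{m=1}^{n}\binom{n}{m}(1-x)^{n-m}\big(D_{m}^{(c)}(x,y)-mD_{m-1}^{(c)}(x,y)\big)=\begin{cases}(-1)^{k}y^{2k}, & \text{if } n=2k,\\ 0, & \text{if } n=2k-1.\end{cases}$$
   Context: The cosine-derangement polynomials $D_n^{(c)}(x,y)$, $n\ge 0$, are defined by the generating function (power series in $t$) $\displaystyle\frac{e^{-t}}{1-t}e^{xt}\cos(yt)=\sum_{n=0}^{\infty}D_{n}^{(c)}(x,y)\frac{t^{n}}{n!}$. Convention: $0^0=1$. *)

theory Defs
  imports Complex_Main "HOL-Computational_Algebra.Formal_Power_Series"
begin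

(* In the ring of formal power series over a field, 1 - fps_X is a unit, so the
   division below is multiplication by the geometric series. *)
definition cos_derangement_gf :: "real \<Rightarrow> real \<Rightarrow> real fps" where
  "cos_derangement_gf x y = fps_exp (-1) / (1 - fps_X) * fps_exp x * fps_cos y"

definition cos_derangement :: "nat \<Rightarrow> real \<Rightarrow> real \<Rightarrow> real" where
  "cos_derangement n x y = fact n * fps_nth (cos_derangement_gf x y) n"

lemma cos_derangement_gf:
  "cos_derangement_gf x y = Abs_fps (\<lambda>n. cos_derangement n x y / fact n)"
  by (rule fps_ext) (simp add: cos_derangement_def)

end

theory Submission
  imports Defs
begin

text \<open>
  Multiplying the generating function of the polynomials by \<open>1 - t\<close> cancels the
  geometric series and leaves \<open>e\<^bsup>(x-1)t\<^esup> cos(yt)\<close>; its exponential coefficients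
  are exactly the differences \<open>D\<^sub>m - m D\<^bsub>m-1\<^esub>\<close>. Multiplying further by \<open>e\<^bsup>(1-x)t\<^esup>\<close> leaves
  \<open>cos(yt)\<close>, while on exponential coefficients this product is the binomial convolution with
  the powers of \<open>1 - x\<close>. So the sum over all \<open>m\<close> is \<open>n!\<close> times the \<open>n\<close>-th coefficient of
  \<open>cos(yt)\<close>. The isolated \<open>(1 - x)\<^sup>n\<close> is the term \<open>m = 0\<close>, because \<open>D\<^sub>0 = 1\<close>.
\<close>

lemma one_minus_X_times_cos_derangement_gf:
  "(1 - fps_X) * cos_derangement_gf x y = fps_exp (x - 1) * fps_cos y"
proof -
  have unit: "(1 - fps_X :: real fps) * (fps_exp (-1) / (1 - fps_X)) = fps_exp (-1)"
    by (subst fps_divide_unit) (simp_all add: inverse_mult_eq_1' mult.left_commute)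
  have "(1 - fps_X) * cos_derangement_gf x y
      = ((1 - fps_X) * (fps_exp (-1) / (1 - fps_X))) * fps_exp x * fps_cos y"
    by (simp only: cos_derangement_gf_def mult.assoc)
  also have "\<dots> = fps_exp (x - 1) * fps_cos y"
    by (simp add: unit flip: fps_exp_add_mult)
  finally show ?thesis .
qed

text \<open>
  At \<open>m = 0\<close> the left-hand side is \<open>D\<^sub>0\<close> whatever value the truncated index \<open>m - 1\<close> selects,
  since its factor vanishes.
\<close>

lemma cos_derangement_diff_conv_coeff:
  "cos_derangement m x y - real m * cos_derangement (m - 1) x y
    = fact m * fps_nth (fps_exp (x - 1) * fps_cos y) m"
proof -
  have "fact m * fps_nth ((1 - fps_X) * cos_derangement_gf x y) m
      = cos_derangement m x y - real m * cos_derangement (m - 1) x y"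
    by (cases m) (simp_all add: cos_derangement_def algebra_simps)
  then show ?thesis
    by (simp add: one_minus_X_times_cos_derangement_gf)
qed

lemma fps_exp_mult_nth_conv_binomial_sum:
  fixes f :: "'a :: field_char_0 fps"
  shows "fact n * fps_nth (fps_exp c * f) n
    = (\<Sum>m\<le>n. of_nat (n choose m) * c ^ (n - m) * (fact m * fps_nth f m))"
proof -
  have "fact n * fps_nth (f * fps_exp c) n
      = (\<Sum>m\<le>n. fact n * (fps_nth f m * (c ^ (n - m) / fact (n - m))))"
    by (simp add: fps_mult_nth sum_distrib_left atLeast0AtMost)
  also have "\<dots> = (\<Sum>m\<le>n. of_nat (n choose m) * c ^ (n - m) * (fact m * fps_nth f m))"
    by (rule sum.cong) (simp_all add: binomial_fact)
  finally show ?thesis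
    by (simp add: mult.commute)
qed

theorem theorem9:
  fixes x y :: real and k n :: nat
  assumes "k \<ge> 1"
    and "n = 2 * k \<or> n = 2 * k - 1"
  shows "(1 - x) ^ n
      + (\<Sum>m = 1..n. real (n choose m) * (1 - x) ^ (n - m)
           * (cos_derangement m x y - real m * cos_derangement (m - 1) x y))
    = (if n = 2 * k then (-1) ^ k * y ^ (2 * k) else 0)"
proof -
  let ?f = "fps_exp (x - 1) * fps_cos y"
  let ?term = "\<lambda>m. real (n choose m) * (1 - x) ^ (n - m) * (fact m * fps_nth ?f m)"
  have "(1 - x) ^ n
      + (\<Sum>m = 1..n. real (n choose m) * (1 - x) ^ (n - m)
           * (cos_derangement m x y - real m * cos_derangement (m - 1) x y))
      = ?term 0 + (\<Sum>m = 1..n. ?term m)"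
    by (simp only: cos_derangement_diff_conv_coeff) (simp add: fps_cos_def)
  also have "\<dots> = (\<Sum>m\<le>n. ?term m)"
    by (simp add: sum.atLeast_Suc_atMost flip: atLeast0AtMost)
  also have "\<dots> = fact n * fps_nth (fps_exp (1 - x) * ?f) n"
    by (simp only: fps_exp_mult_nth_conv_binomial_sum)
  also have "fps_exp (1 - x) * ?f = fps_cos y"
    by (simp add: mult.assoc[symmetric] flip: fps_exp_add_mult)
  also have "fact n * fps_nth (fps_cos y) n
      = (if n = 2 * k then (-1) ^ k * y ^ (2 * k) else 0)"
    using assms by (auto simp: fps_cos_def)
  finally show ?thesis .
qed

end
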